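(* Let $n\ge 2$ be an integer and let $X$ and $Y$ be real $n$-normed spaces, each of dimension at least $n$. Let $f:X\to Y$ be a surjective mapping having the $n$-distance one preserving property, i.e. for all $x_1,\dots,x_n,y_1,\dots,y_n\in X$, $$\|x_1-y_1,\dots,x_n-y_n\|=1\ \Longrightarrow\ \|f(x_1)-f(y_1),\dots,f(x_n)-f(y_n)\|=1.$$ Then $f$ is an affine $n$-isometry.
   Context: All linear spaces are real. An $n$-norm on a real vector space $X$ of dimension at least $n$ is a map $\|\cdot,\dots,\cdot\|:X^n\to\mathbb{R}$ such that: (a) $\|x_1,\dots,x_n\|=0$ if and only if $x_1,\dots,x_n$ are linearly dependent; (b) $\|x_1,\dots,x_n\|$ is invariant under permutation of its arguments; (c) $\|\alpha x_1,x_2,\dots,x_n\|=|\alpha|\,\|x_1,\dots,x_n\|$ for all $\alpha\in\mathbb{R}$; (d) $\|x_0+x_1,x_2,\dots,x_n\|\le\|x_0,x_2,\dots,x_n\|+\|x_1,x_2,\dots,x_n\|$. An $n$-normed space is a vector space with an $n$-norm. A mapping $f:X\to Y$ between $n$-normed spaces is an $n$-isometry if $\|f(x_1)-f(y_1),\dots,f(x_n)-f(y_n)\|=\|x_1-y_1,\dots,x_n-y_n\|$ for all $x_1,\dots,x_n,y_1,\dots,y_n\in X$. It is affine if $x\mapsto f(x)-f(0)$ is linear over $\mathbb{R}$. *)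

theory Defs
  imports Complex_Main "HOL-Library.Multiset"
begin

text \<open>An \<open>n\<close>-tuple of vectors is a list of length \<open>n\<close>.  Linear dependence is that of the family,
  so a tuple with a repeated entry is dependent; \<^const>\<open>dependent\<close> applied to the set of entries
  would not see the repetition.\<close>

definition lin_dependent_tuple :: "'a::real_vector list \<Rightarrow> bool" where
  "lin_dependent_tuple xs \<longleftrightarrow>
     (\<exists>c :: nat \<Rightarrow> real. (\<exists>i<length xs. c i \<noteq> 0) \<and> (\<Sum>i<length xs. c i *\<^sub>R xs ! i) = 0)"

text \<open>The underlying vector space is the whole type \<^typ>\<open>'a\<close>.  The dimension bound is stated with an
  independent set because \<^const>\<open>dim\<close> is 0 on infinite-dimensional spaces.  Values of \<open>N\<close> on lists of
  length other than \<open>n\<close> are unconstrained and irrelevant.\<close>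

locale n_normed_space =
  fixes n :: nat and N :: "'a::real_vector list \<Rightarrow> real"
  assumes dim_ge: "\<exists>B :: 'a set. independent B \<and> finite B \<and> card B = n"
    and zero_iff: "length xs = n \<Longrightarrow> N xs = 0 \<longleftrightarrow> lin_dependent_tuple xs"
    and perm: "length xs = n \<Longrightarrow> mset ys = mset xs \<Longrightarrow> N ys = N xs"
    and scale: "length (x # xs) = n \<Longrightarrow> N ((a *\<^sub>R x) # xs) = \<bar>a\<bar> * N (x # xs)"
    and triangle: "length (x # xs) = n \<Longrightarrow> N ((w + x) # xs) \<le> N (w # xs) + N (x # xs)"

definition preserves_n_distance_one ::
  "nat \<Rightarrow> ('a::real_vector list \<Rightarrow> real) \<Rightarrow> ('b::real_vector list \<Rightarrow> real) \<Rightarrow> ('a \<Rightarrow> 'b) \<Rightarrow> bool" where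
  "preserves_n_distance_one n NX NY f \<longleftrightarrow>
     (\<forall>xs ys. length xs = n \<longrightarrow> length ys = n \<longrightarrow>
        NX (map2 (\<lambda>x y. x - y) xs ys) = 1 \<longrightarrow> NY (map2 (\<lambda>x y. f x - f y) xs ys) = 1)"

definition n_isometry ::
  "nat \<Rightarrow> ('a::real_vector list \<Rightarrow> real) \<Rightarrow> ('b::real_vector list \<Rightarrow> real) \<Rightarrow> ('a \<Rightarrow> 'b) \<Rightarrow> bool" where
  "n_isometry n NX NY f \<longleftrightarrow>
     (\<forall>xs ys. length xs = n \<longrightarrow> length ys = n \<longrightarrow>
        NY (map2 (\<lambda>x y. f x - f y) xs ys) = NX (map2 (\<lambda>x y. x - y) xs ys))"

definition affine_map :: "('a::real_vector \<Rightarrow> 'b::real_vector) \<Rightarrow> bool" where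
  "affine_map f \<longleftrightarrow> linear (\<lambda>x. f x - f 0)"

end

theory Submission imports Defs begin

text \<open>Let \<open>W\<close> be the span of \<open>n - 1\<close> independent vectors \<open>w\<^sub>i\<close> and \<open>g = f - f 0\<close>.  If \<open>C\<close> is a
  difference \<open>f x - f y\<close> with \<open>x - y \<in> W\<close>, a detour through a point at \<open>n\<close>-distance one from both
  \<open>x\<close> and \<open>y\<close> shows that the \<open>n\<close>-norm of \<open>C, g w\<^sub>1, \<dots>, g w\<^sub>n\<^sub>-\<^sub>1\<close> is at most 2.  Since the \<open>w\<^sub>i\<close> may be
  rescaled without changing \<open>W\<close>, surjectivity makes every natural multiple of \<open>C / 3\<close> again such a
  difference, so the \<open>n\<close>-norm is 0.  Hence parallel hyperplanes of this kind, and by intersecting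
  them parallel lines, go to parallel ones.  Parallelograms then give additivity of \<open>g\<close>, and the
  factor by which \<open>g\<close> transports scalars is a ring endomorphism of the reals, thus the identity.\<close>

section \<open>Linear independence, spans, and ring endomorphisms of the reals\<close>

text \<open>For distinct entries, coefficients indexed by positions and by vectors correspond
  bijectively; a repeated entry gives a relation with coefficients 1 and -1.\<close>

lemma lin_dependent_tuple_iff:
  "lin_dependent_tuple xs \<longleftrightarrow> \<not> distinct xs \<or> dependent (set xs)"
proof
  assume "lin_dependent_tuple xs"
  then obtain c where c: "\<exists>i<length xs. c i \<noteq> 0" "(\<Sum>i<length xs. c i *\<^sub>R xs ! i) = 0"
    unfolding lin_dependent_tuple_def by blast
  then obtain k where k: "k < length xs" "c k \<noteq> 0" by blast
  show "\<not> distinct xs \<or> dependent (set xs)"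
  proof (rule disjCI)
    assume "\<not> dependent (set xs)" 
    show "\<not> distinct xs"
    proof
      assume d: "distinct xs"
      have bij: "bij_betw ((!) xs) {..<length xs} (set xs)"
        using d by (simp add: bij_betw_nth)
      define u where "u v = c (the_inv_into {..<length xs} ((!) xs) v)" for v
      have u: "u (xs ! i) = c i" if "i < length xs" for i
        using that bij by (simp add: u_def the_inv_into_f_f bij_betw_def)
      have "(\<Sum>v\<in>set xs. u v *\<^sub>R v) = (\<Sum>i<length xs. u (xs ! i) *\<^sub>R xs ! i)"
        using sum.reindex_bij_betw[OF bij, of "\<lambda>v. u v *\<^sub>R v"] by simp
      also have "\<dots> = 0" using c(2) u by simp
      finally have "dependent (set xs)"
        using k u[of k] by (auto simp: real_vector.dependent_finite intro!: exI[of _ u] bexI[of _ "xs ! k"])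
      with \<open>\<not> dependent (set xs)\<close> show False by simp
    qed
  qed
next
  assume a: "\<not> distinct xs \<or> dependent (set xs)"
  show "lin_dependent_tuple xs"
  proof (cases "distinct xs")
    case False
    then obtain i j where ij: "i < length xs" "j < length xs" "i \<noteq> j" "xs ! i = xs ! j"
      by (auto simp: distinct_conv_nth)
    define c :: "nat \<Rightarrow> real" where "c k = (if k = i then 1 else if k = j then - 1 else 0)" for k
    have "(\<Sum>k<length xs. c k *\<^sub>R xs ! k) = (\<Sum>k\<in>{i, j}. c k *\<^sub>R xs ! k)"
      using ij by (intro sum.mono_neutral_right) (auto simp: c_def)
    also have "\<dots> = 0" using ij by (simp add: c_def)
    finally show ?thesis
      unfolding lin_dependent_tuple_def using ij(1) by (intro exI[of _ c]) (auto simp: c_def)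
  next
    case True
    with a obtain u where u: "\<exists>v\<in>set xs. u v \<noteq> 0" "(\<Sum>v\<in>set xs. u v *\<^sub>R v) = 0"
      by (auto simp: real_vector.dependent_finite)
    have bij: "bij_betw ((!) xs) {..<length xs} (set xs)"
      using True by (simp add: bij_betw_nth)
    have "(\<Sum>i<length xs. u (xs ! i) *\<^sub>R xs ! i) = 0"
      using u(2) sum.reindex_bij_betw[OF bij, of "\<lambda>v. u v *\<^sub>R v"] by simp
    with u(1) show ?thesis
      unfolding lin_dependent_tuple_def
      by (intro exI[of _ "\<lambda>i. u (xs ! i)"]) (auto simp: in_set_conv_nth)
  qed
qed

text \<open>Representations over \<open>B\<close> are unique, so lying in the span of
  \<open>B - {b}\<close> forces the coefficient at \<open>b\<close> to vanish. This is the tool for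
  intersecting hyperplanes down to a line.\<close>

lemma span_remove_independent:
  fixes B :: "'a::real_vector set"
  assumes "independent B" "T \<subseteq> B" "x \<in> span B" "\<And>b. b \<in> T \<Longrightarrow> x \<in> span (B - {b})"
  shows "x \<in> span (B - T)"
proof -
  let ?r = "representation B x"
  have "?r b = 0" if "b \<in> T" for b
  proof -
    have "?r = representation (B - {b}) x"
      using assms that by (intro real_vector.representation_extend) auto
    then show ?thesis
      using real_vector.representation_ne_zero[of "B - {b}" x b] by auto
  qed
  then have sub: "{b. ?r b \<noteq> 0} \<subseteq> B - T"
    using real_vector.representation_ne_zero[of B x] by auto
  have "(\<Sum>b | ?r b \<noteq> 0. ?r b *\<^sub>R b) \<in> span (B - T)"
    using sub by (intro real_vector.span_sum real_vector.span_scale real_vector.span_base) auto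
  then show ?thesis
    using real_vector.sum_nonzero_representation_eq[OF assms(1,3)] by simp
qed

lemma not_in_span_sym:
  fixes x y :: "'a::real_vector"
  assumes "x \<notin> span {y}" "y \<noteq> 0"
  shows "y \<notin> span {x}"
proof
  assume "y \<in> span {x}"
  then obtain k where "y = k *\<^sub>R x" by (auto simp: real_vector.span_singleton)
  moreover from this have "k \<noteq> 0" using assms by auto
  ultimately have "x = (1 / k) *\<^sub>R y" by simp
  then show False using assms by (auto simp: real_vector.span_singleton)
qed

lemma independent_pair_coeff_eq:
  fixes x y :: "'a::real_vector"
  assumes "x \<notin> span {y}" "y \<noteq> 0" "a *\<^sub>R x + b *\<^sub>R y = c *\<^sub>R x + d *\<^sub>R y"
  shows "a = c \<and> b = d"
proof -
  have e: "(a - c) *\<^sub>R x = (d - b) *\<^sub>R y"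
    using assms(3) by (simp add: algebra_simps)
  have "a = c"
  proof (rule ccontr)
    assume "a \<noteq> c"
    then have "x = (1 / (a - c)) *\<^sub>R ((a - c) *\<^sub>R x)" by simp
    also have "\<dots> \<in> span {y}" unfolding e by (auto simp: real_vector.span_singleton)
    finally show False using assms by simp
  qed
  then show ?thesis using e assms by simp
qed

text \<open>Nonnegative reals are squares, so \<open>h\<close> is monotone; it fixes the rationals,
  and their density leaves no room for \<open>h t\<close> to differ from \<open>t\<close>.\<close>

lemma real_ring_endomorphism_id:
  fixes h :: "real \<Rightarrow> real"
  assumes one: "h 1 = 1" and add: "\<And>s t. h (s + t) = h s + h t"
    and mult: "\<And>s t. h (s * t) = h s * h t"
  shows "h t = t"
proof -
  interpret additive h by standard (rule add)
  have nat: "h (real m) = real m" for m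
    by (induction m) (simp_all add: zero add one)
  have int: "h (of_int k) = of_int k" for k
    by (cases k rule: int_cases2) (simp_all add: nat minus)
  have rat: "h q = q" if "q \<in> \<rat>" for q
  proof -
    from that obtain a b :: int where b: "b \<noteq> 0" and q: "q = of_int a / of_int b"
      by (auto simp: Rats_eq_int_div_int)
    have "h q * of_int b = h (q * of_int b)" by (simp add: mult int)
    also have "\<dots> = of_int a" using b q by (simp add: int)
    also have "\<dots> = q * of_int b" using b q by simp
    finally show ?thesis using b by simp
  qed
  have pos: "h s \<ge> 0" if "s \<ge> 0" for s
    using mult[of "sqrt s" "sqrt s"] that by simp
  have mono: "h s \<le> h u" if "s \<le> u" for s u
    using pos[of "u - s"] that by (simp add: diff)
  show ?thesis
  proof (rule ccontr)
    assume "h t \<noteq> t"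
    then consider "h t < t" | "t < h t" by linarith
    then show False
    proof cases
      case 1
      then obtain q where "q \<in> \<rat>" "h t < q" "q < t" using Rats_dense_in_real by blast
      then show False using mono[of q t] rat[of q] by simp
    next
      case 2
      then obtain q where "q \<in> \<rat>" "t < q" "q < h t" using Rats_dense_in_real by blast
      then show False using mono[of t q] rat[of q] by simp
    qed
  qed
qed

section \<open>Elementary properties of \<open>n\<close>-norms\<close>

context n_normed_space
begin

lemma eq_0_iff: "length xs = n \<Longrightarrow> N xs = 0 \<longleftrightarrow> \<not> (distinct xs \<and> independent (set xs))"
  by (simp add: zero_iff lin_dependent_tuple_iff)

text \<open>Apply the triangle inequality to \<open>- x + x = 0\<close>: the tuple with first entry
  0 has value 0, and \<open>- x\<close> has the same value as \<open>x\<close>.\<close>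

lemma nonneg:
  assumes "length (x # xs) = n"
  shows "N (x # xs) \<ge> 0"
  using triangle[OF assms, of "- x"] scale[OF assms, of "- 1"] scale[OF assms, of 0] by simp

lemma eq_0_iff_span:
  assumes "length (x # xs) = n" "distinct xs" "independent (set xs)"
  shows "N (x # xs) = 0 \<longleftrightarrow> x \<in> span (set xs)"
  using assms by (auto simp: eq_0_iff real_vector.independent_insert real_vector.span_base
      split: if_splits)

lemma eq_0_if_span:
  assumes "length (x # xs) = n" "x \<in> span (set xs)"
  shows "N (x # xs) = 0"
  using assms by (auto simp: eq_0_iff real_vector.independent_insert)

text \<open>In its first argument the \<open>n\<close>-norm is a seminorm vanishing on the span of
  the others, so it only sees the class modulo that span.\<close>

lemma cong_span:
  assumes "length (x # xs) = n" "x - y \<in> span (set xs)"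
  shows "N (x # xs) = N (y # xs)"
proof -
  have le: "N (a # xs) \<le> N (b # xs)" if "a - b \<in> span (set xs)" for a b
    using triangle[of b xs "a - b"] eq_0_if_span[of "a - b" xs] assms(1) that by simp
  have "y - x \<in> span (set xs)"
    using real_vector.span_neg[OF assms(2)] by simp
  with le assms(2) show ?thesis by (intro antisym) auto
qed

lemma swap: "length (x # y # xs) = n \<Longrightarrow> N (y # x # xs) = N (x # y # xs)"
  by (rule perm) auto

lemma normalise:
  assumes "length (x # xs) = n" "distinct (x # xs)" "independent (set (x # xs))"
  obtains s where "s \<noteq> 0" "N ((s *\<^sub>R x) # xs) = 1"
proof -
  have "N (x # xs) > 0"
    using nonneg[OF assms(1)] eq_0_iff[OF assms(1)] assms(2,3) by linarith
  then show thesis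
    using that[of "1 / N (x # xs)"] scale[OF assms(1)] by simp
qed

lemma ex_not_in_span:
  fixes xs :: "'a list"
  assumes "length xs < n"
  obtains v where "v \<notin> span (set xs)"
proof -
  obtain B :: "'a set" where B: "independent B" "card B = n" using dim_ge by blast
  have "\<not> B \<subseteq> span (set xs)"
    using real_vector.independent_span_bound[OF _ B(1), of "set xs"] B(2) assms
      card_length[of xs] by auto
  then show thesis using that by blast
qed

lemma extend:
  fixes xs :: "'a list"
  assumes "distinct xs" "independent (set xs)" "length xs \<le> n"
  shows "\<exists>zs. length (xs @ zs) = n \<and> distinct (xs @ zs) \<and> independent (set (xs @ zs))"
  using assms
proof (induction "n - length xs" arbitrary: xs)
  case 0
  then show ?case by (intro exI[of _ "[]"]) simp
next
  case (Suc k)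
  then have "length xs < n" by linarith
  then obtain v where v: "v \<notin> span (set xs)" by (rule ex_not_in_span)
  then have "v \<notin> set xs" using real_vector.span_base by blast
  have "k = n - length (xs @ [v])" "length (xs @ [v]) \<le> n"
    using Suc.hyps(2) by auto
  moreover have "distinct (xs @ [v])" "independent (set (xs @ [v]))"
    using v \<open>v \<notin> set xs\<close> Suc.prems by (auto simp: real_vector.independent_insert)
  ultimately obtain zs where
    "length ((xs @ [v]) @ zs) = n \<and> distinct ((xs @ [v]) @ zs) \<and> independent (set ((xs @ [v]) @ zs))"
    using Suc.hyps(1) by blast
  then show ?case by (intro exI[of _ "v # zs"]) simp
qed

end

section \<open>Images of parallel hyperplanes\<close>

locale surj_n_distance_one = X: n_normed_space n NX + Y: n_normed_space n NY
  for n :: nat and NX :: "'a::real_vector list \<Rightarrow> real" and NY :: "'b::real_vector list \<Rightarrow> real" +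
  fixes f :: "'a \<Rightarrow> 'b"
  assumes n_ge_2: "n \<ge> 2" and surj: "surj f" and pres: "preserves_n_distance_one n NX NY f"
begin

definition g :: "'a \<Rightarrow> 'b" where "g x = f x - f 0"

lemma g_0 [simp]: "g 0 = 0"
  by (simp add: g_def)

text \<open>Only the first pair of points keeps a free base point \<open>p\<close>; all others start
  at 0, which turns their image differences into values of \<open>g\<close>.\<close>

lemma unit_diff:
  assumes "length (v # ws) = n" "NX (v # ws) = 1"
  shows "NY ((f (p + v) - f p) # map g ws) = 1"
proof -
  have "map2 (\<lambda>x y. x - y) ((p + v) # ws) (p # replicate (length ws) 0) = v # ws"
    by (auto intro!: nth_equalityI)
  moreover have "map2 (\<lambda>x y. f x - f y) ((p + v) # ws) (p # replicate (length ws) 0) =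
      (f (p + v) - f p) # map g ws"
    by (auto intro!: nth_equalityI simp: g_def)
  ultimately show ?thesis
    using pres assms unfolding preserves_n_distance_one_def
    by (metis length_Cons length_replicate)
qed

lemma diff_le_2:
  assumes ws: "length ws = n - 1" "distinct ws" "independent (set ws)"
    and u: "u \<in> span (set ws)"
  shows "NY ((f (p + u) - f p) # map g ws) \<le> 2"
proof -
  have len: "length (a # ws) = n" "length (b # map g ws) = n" for a b
    using ws n_ge_2 by auto
  obtain v0 where v0: "v0 \<notin> span (set ws)"
    using X.ex_not_in_span[of ws] ws n_ge_2 by auto
  then have "v0 \<notin> set ws" using real_vector.span_base by blast
  then obtain s where s: "NX ((s *\<^sub>R v0) # ws) = 1"
    using X.normalise[of v0 ws] v0 ws len by (auto simp: real_vector.independent_insert)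
  define v where "v = s *\<^sub>R v0"
  \<comment> \<open>Modulo the span of \<open>ws\<close>, \<open>u - v\<close> is
    \<open>- v\<close>; hence \<open>p + v\<close>, chosen at \<open>n\<close>-distance one from
    \<open>p\<close>, has the same distance from \<open>p + u\<close>.\<close>
  have "NX ((u - v) # ws) = NX ((- v) # ws)"
    using u by (intro X.cong_span len) simp
  also have "\<dots> = 1"
    using X.scale[OF len(1), of "- 1" v] s by (simp add: v_def)
  finally have "NY ((f ((p + v) + (u - v)) - f (p + v)) # map g ws) = 1"
    by (intro unit_diff len)
  moreover have "NY ((f (p + v) - f p) # map g ws) = 1"
    using s by (intro unit_diff len) (simp add: v_def)
  ultimately show ?thesis
    using Y.triangle[OF len(2), of "f (p + u) - f (p + v)" "f (p + v) - f p"] by simp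
qed

text \<open>Put \<open>C = f (p + u) - f p\<close>.  If preimages of \<open>f q\<close> and \<open>f q + C / 3\<close> differed by a vector
  outside the hyperplane,
  rescaling one of the \<open>ws\<close> would make the corresponding \<open>n\<close>-distance equal to 1, although
  it is at most 2/3 by the previous lemma.\<close>

lemma third_step:
  assumes ws: "length ws = n - 1" "distinct ws" "independent (set ws)"
    and u: "u \<in> span (set ws)"
  shows "\<exists>w\<in>span (set ws). f (q + w) = f q + (1 / 3) *\<^sub>R (f (p + u) - f p)"
proof -
  let ?C = "f (p + u) - f p"
  obtain q' where q': "f q' = f q + (1 / 3) *\<^sub>R ?C" using surj by (metis surjD)
  define v where "v = q' - q"
  have "v \<in> span (set ws)"
  proof (rule ccontr)
    assume v: "v \<notin> span (set ws)"
    then have "v \<notin> set ws" using real_vector.span_base by blast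
    obtain w ws' where [simp]: "ws = w # ws'" using ws n_ge_2 by (cases ws) auto
    have len: "length (a # b # ws') = n" "length (c # map g (b # ws')) = n" for a b c
      using ws n_ge_2 by auto
    have "independent (insert v (set ws))" using v ws by (simp add: real_vector.independent_insert)
    then have "independent (set (w # v # ws'))" by (simp add: insert_commute)
    then obtain s where s: "s \<noteq> 0" "NX ((s *\<^sub>R w) # v # ws') = 1"
      using X.normalise[of w "v # ws'"] len ws \<open>v \<notin> set ws\<close> by auto
    then have one: "NX (v # (s *\<^sub>R w) # ws') = 1" using X.swap len by metis
    have "NY ((f (q + v) - f q) # map g ((s *\<^sub>R w) # ws')) = 1"
      by (intro unit_diff one len)
    \<comment> \<open>The first entry was a third of \<open>?C\<close>. The value 3 exceeds the
      bound 2, whereas halving \<open>?C\<close> would only give 2 and no contradiction.\<close>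
    then have "NY (?C # map g ((s *\<^sub>R w) # ws')) = 3"
      using Y.scale[OF len(2), of "1 / 3" ?C "s *\<^sub>R w"] q' by (simp add: v_def)
    moreover have "distinct ((s *\<^sub>R w) # ws') \<and> independent (set ((s *\<^sub>R w) # ws'))"
    proof -
      have "distinct (v # (s *\<^sub>R w) # ws') \<and> independent (set (v # (s *\<^sub>R w) # ws'))"
        using one X.eq_0_iff[OF len(1), of v "s *\<^sub>R w"] by auto
      then show ?thesis
        using real_vector.independent_mono[of "set (v # (s *\<^sub>R w) # ws')" "set ((s *\<^sub>R w) # ws')"]
        by auto
    qed
    \<comment> \<open>Since \<open>s\<close> is nonzero, rescaling \<open>w\<close> leaves the
      hyperplane unchanged, so the bound also applies to the rescaled tuple.\<close>
    moreover have "u \<in> span (set ((s *\<^sub>R w) # ws'))"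
    proof -
      have "w = (1 / s) *\<^sub>R (s *\<^sub>R w)" using s by simp
      then have "w \<in> span (insert (s *\<^sub>R w) (set ws'))"
        by (metis insertI1 real_vector.span_base real_vector.span_scale)
      then have "set ws \<subseteq> span (insert (s *\<^sub>R w) (set ws'))"
        by (auto intro: real_vector.span_base)
      then show ?thesis
        using u real_vector.span_minimal[of "set ws" "span (insert (s *\<^sub>R w) (set ws'))"] by auto
    qed
    ultimately show False
      using diff_le_2[of "(s *\<^sub>R w) # ws'" u p] ws by auto
  qed
  then show ?thesis using q' by (intro bexI[of _ v]) (auto simp: v_def)
qed

text \<open>Third steps are chained. The starting point in \<open>third_step\<close> need not be
  \<open>p\<close>, so the same vector can be added again from each point \<open>p + w\<close>
  reached.\<close>

lemma multiple_step:
  assumes ws: "length ws = n - 1" "distinct ws" "independent (set ws)"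
    and u: "u \<in> span (set ws)"
  shows "\<exists>w\<in>span (set ws). f (p + w) = f p + (real m / 3) *\<^sub>R (f (p + u) - f p)"
proof (induction m)
  case 0
  then show ?case by (intro bexI[of _ 0]) (auto simp: real_vector.span_zero)
next
  case (Suc m)
  then obtain w where w: "w \<in> span (set ws)"
    "f (p + w) = f p + (real m / 3) *\<^sub>R (f (p + u) - f p)" by blast
  obtain w' where w': "w' \<in> span (set ws)"
    "f (p + w + w') = f (p + w) + (1 / 3) *\<^sub>R (f (p + u) - f p)"
    using third_step[OF ws u] by blast
  have "f (p + (w + w')) = f p + (real (Suc m) / 3) *\<^sub>R (f (p + u) - f p)"
    using w(2) w'(2) by (simp add: add.assoc add_divide_distrib scaleR_left_distrib)
  then show ?case using w(1) w'(1) real_vector.span_add by blast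
qed

lemma diff_eq_0:
  assumes ws: "length ws = n - 1" "distinct ws" "independent (set ws)"
    and u: "u \<in> span (set ws)"
  shows "NY ((f (p + u) - f p) # map g ws) = 0"
proof (rule ccontr)
  let ?C = "f (p + u) - f p"
  have len: "length (b # map g ws) = n" for b
    using ws n_ge_2 by auto
  assume "NY (?C # map g ws) \<noteq> 0"
  then have "NY (?C # map g ws) > 0" using Y.nonneg[OF len, of ?C] by simp
  \<comment> \<open>The threshold 6 is 3 times the bound 2, because the available multiple of
    \<open>?C\<close> is \<open>m / 3\<close>.\<close>
  then obtain m where m: "real m * NY (?C # map g ws) > 6"
    using reals_Archimedean3 by blast
  obtain w where w: "w \<in> span (set ws)" "f (p + w) = f p + (real m / 3) *\<^sub>R ?C"
    using multiple_step[OF ws u] by blast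
  have "NY (((real m / 3) *\<^sub>R ?C) # map g ws) \<le> 2"
    using diff_le_2[OF ws w(1), of p] w(2) by simp
  then show False using m Y.scale[OF len, of "real m / 3" ?C] by simp
qed

section \<open>Images of parallel lines\<close>

text \<open>Complete \<open>a\<close> to an independent \<open>n\<close>-tuple. Omitting any one of
  the other vectors leaves a hyperplane containing \<open>a\<close>, to which
  \<open>diff_eq_0\<close> applies; the corresponding spans of images intersect in the line of
  \<open>g a\<close>.\<close>

lemma diff_in_span_g:
  assumes "a \<noteq> 0"
  shows "f (p + r *\<^sub>R a) - f p \<in> span {g a}"
proof -
  let ?C = "f (p + r *\<^sub>R a) - f p"
  obtain zs where zs: "length (a # zs) = n" "distinct (a # zs)" "independent (set (a # zs))"
    using X.extend[of "[a]"] assms n_ge_2 by auto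
  then obtain z zs' where z: "zs = z # zs'" using n_ge_2 by (cases zs) auto
  \<comment> \<open>The rescaling is done on \<open>z\<close>, so that \<open>a\<close>, and with it
    \<open>g a\<close>, stays as it is.\<close>
  have "independent (set (z # a # zs'))" using zs z by (simp add: insert_commute)
  then obtain s where s: "s \<noteq> 0" "NX ((s *\<^sub>R z) # a # zs') = 1"
    using X.normalise[of z "a # zs'"] zs z by auto
  define ws where "ws = (s *\<^sub>R z) # zs'"
  have one: "NX (a # ws) = 1" and len: "length (a # ws) = n"
    using s X.swap[of "s *\<^sub>R z" a zs'] zs z by (auto simp: ws_def)
  have ind: "distinct (a # ws)" "independent (set (a # ws))"
    using one X.eq_0_iff[OF len] by auto
  \<comment> \<open>The normalised tuple has an image of \<open>n\<close>-norm one, which is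
    therefore independent; the intersection argument below rests on this.\<close>
  have "NY (map g (a # ws)) = 1"
    using unit_diff[OF len one, of 0] by (simp add: g_def)
  then have gind: "distinct (map g (a # ws))" "independent (set (map g (a # ws)))"
    using Y.eq_0_iff[of "map g (a # ws)"] len by auto
  have hyp: "?C \<in> span (set (map g (a # ws)) - {b})" if b: "b \<in> g ` set ws" for b
  proof -
    obtain w ys xs where w: "ws = ys @ w # xs" "b = g w"
      using b by (metis imageE split_list)
    let ?l = "a # ys @ xs"
    have l: "length ?l = n - 1" "distinct ?l" "independent (set ?l)"
      using len ind w real_vector.independent_mono[of "set (a # ws)" "set ?l"] by auto
    have "r *\<^sub>R a \<in> span (set ?l)" by (intro real_vector.span_scale real_vector.span_base) simp
    then have "NY (?C # map g ?l) = 0" by (rule diff_eq_0[OF l])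
    moreover have "distinct (map g ?l)" "independent (set (map g ?l))"
      using gind w real_vector.independent_mono[of "set (map g (a # ws))" "set (map g ?l)"] by auto
    moreover have "length (?C # map g ?l) = n" using len w by simp
    ultimately have "?C \<in> span (set (map g ?l))" using Y.eq_0_iff_span by blast
    moreover have "set (map g ?l) = set (map g (a # ws)) - {b}"
      using gind w by auto
    ultimately show ?thesis by simp
  qed
  have ne: "ws \<noteq> []" by (simp add: ws_def)
  have "?C \<in> span (set (map g (a # ws)) - g ` set ws)"
  proof (rule span_remove_independent)
    show "?C \<in> span (set (map g (a # ws)))"
      using hyp[of "g (hd ws)"] ne real_vector.span_mono[of "set (map g (a # ws)) - {g (hd ws)}"]
      by (auto simp: subset_iff)
  qed (use gind hyp in auto)
  moreover have "set (map g (a # ws)) - g ` set ws = {g a}"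
    using gind by auto
  ultimately show ?thesis by simp
qed

lemma g_scale_in_span: "a \<noteq> 0 \<Longrightarrow> g (r *\<^sub>R a) \<in> span {g a}"
  using diff_in_span_g[of a 0 r] by (simp add: g_def)

text \<open>Complete \<open>x\<close>, \<open>y\<close> to an \<open>n\<close>-tuple and rescale
  \<open>x\<close> to reach \<open>n\<close>-norm one, so that the images are independent. The
  rescaling is undone with \<open>g_scale_in_span\<close>.\<close>

lemma g_not_in_span:
  assumes "x \<notin> span {y}" "y \<noteq> 0"
  shows "g x \<notin> span {g y}" "g y \<noteq> 0"
proof -
  have "x \<noteq> 0" "x \<noteq> y"
    using assms real_vector.span_zero[of "{y}"] real_vector.span_base[of y "{y}"] by auto
  obtain zs where zs: "length (x # y # zs) = n" "distinct (x # y # zs)"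
    "independent (set (x # y # zs))"
    using X.extend[of "[x, y]"] assms n_ge_2 \<open>x \<noteq> y\<close> by (auto simp: real_vector.independent_insert)
  then obtain s where s: "NX ((s *\<^sub>R x) # y # zs) = 1"
    using X.normalise[of x "y # zs"] by auto
  have "NY (g (s *\<^sub>R x) # g y # map g zs) = 1"
    using unit_diff[OF _ s, of 0] zs by (simp add: g_def)
  then have ind: "distinct (g (s *\<^sub>R x) # g y # map g zs)"
    "independent (set (g (s *\<^sub>R x) # g y # map g zs))"
    using Y.eq_0_iff[of "g (s *\<^sub>R x) # g y # map g zs"] zs by auto
  then have "independent {g (s *\<^sub>R x), g y}" by (rule_tac real_vector.independent_mono) auto
  then have *: "g (s *\<^sub>R x) \<notin> span {g y}" "g y \<noteq> 0"
    using ind by (auto simp: real_vector.independent_insert)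
  show "g y \<noteq> 0" by fact
  show "g x \<notin> span {g y}"
  proof
    assume "g x \<in> span {g y}"
    then have "span {g x} \<subseteq> span {g y}"
      by (intro real_vector.span_minimal real_vector.subspace_span) auto
    with * g_scale_in_span[OF \<open>x \<noteq> 0\<close>, of s] show False by blast
  qed
qed

section \<open>Linearity of the normalised map\<close>

lemma g_add_independent:
  assumes "x \<notin> span {y}"
  shows "g (x + y) = g x + g y"
proof (cases "y = 0")
  case False
  then have "x \<noteq> 0" using assms real_vector.span_zero by blast
  obtain b where b: "f (x + y) - f x = b *\<^sub>R g y"
    using diff_in_span_g[OF False, of x 1] by (auto simp: real_vector.span_singleton)
  obtain a where a: "f (x + y) - f y = a *\<^sub>R g x"
    using diff_in_span_g[OF \<open>x \<noteq> 0\<close>, of y 1]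
    by (auto simp: real_vector.span_singleton add.commute)
  \<comment> \<open>Both sides are \<open>g (x + y)\<close>, reached along the two ways round the
    parallelogram.\<close>
  have "1 *\<^sub>R g x + b *\<^sub>R g y = a *\<^sub>R g x + 1 *\<^sub>R g y"
    unfolding a[symmetric] b[symmetric] by (simp add: g_def)
  then have "b = 1" using independent_pair_coeff_eq g_not_in_span[OF assms False] by blast
  with b show ?thesis by (simp add: g_def algebra_simps)
qed simp

lemma ex_not_in_span_singleton: obtains z :: 'a where "z \<notin> span {y}"
  using X.ex_not_in_span[of "[y]"] n_ge_2 by auto

text \<open>On a common line, an auxiliary \<open>z\<close> off that line helps: expand
  \<open>g (z + x + y)\<close> by splitting off either \<open>z\<close> or \<open>x\<close>, both of
  which fall under the independent case.\<close>

lemma g_add: "g (x + y) = g x + g y"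
proof (cases "x \<in> span {y}")
  case True
  obtain z where z: "z \<notin> span {y}" by (rule ex_not_in_span_singleton)
  have sub: "span {w} \<subseteq> span {y}" if "w \<in> span {y}" for w
    using that by (intro real_vector.span_minimal real_vector.subspace_span) auto
  have yz: "z + y \<notin> span {y}"
    using z real_vector.span_diff[of "z + y" "{y}" y] by (auto simp: real_vector.span_base)
  have xy: "x + y \<in> span {y}"
    using True by (intro real_vector.span_add) (auto simp: real_vector.span_base)
  have "g (z + (x + y)) = g z + g (x + y)"
    using sub[OF xy] z by (intro g_add_independent) auto
  moreover have "g ((z + y) + x) = g (z + y) + g x"
    using sub[OF True] yz by (intro g_add_independent) auto
  moreover have "g (z + y) = g z + g y" by (rule g_add_independent[OF z])
  ultimately show ?thesis by (simp add: algebra_simps)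
qed (rule g_add_independent)

text \<open>The multiple \<open>t *\<^sub>R (x + y)\<close> goes to a multiple of
  \<open>g x + g y\<close>; by independence its factor agrees with those of \<open>x\<close> and of
  \<open>y\<close>.\<close>

lemma g_scale_transfer:
  assumes "y \<notin> span {x}" "x \<noteq> 0" "g (t *\<^sub>R x) = c *\<^sub>R g x"
  shows "g (t *\<^sub>R y) = c *\<^sub>R g y"
proof -
  have "y \<noteq> 0" using assms real_vector.span_zero by blast
  have "x + y \<noteq> 0" using assms real_vector.span_neg[of x "{x}"] real_vector.span_base[of x "{x}"]
    by (auto simp: add_eq_0_iff)
  obtain d where d: "g (t *\<^sub>R y) = d *\<^sub>R g y"
    using g_scale_in_span[OF \<open>y \<noteq> 0\<close>] by (auto simp: real_vector.span_singleton)
  obtain e where e: "g (t *\<^sub>R (x + y)) = e *\<^sub>R g (x + y)"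
    using g_scale_in_span[OF \<open>x + y \<noteq> 0\<close>] by (auto simp: real_vector.span_singleton)
  have "d *\<^sub>R g y + c *\<^sub>R g x = e *\<^sub>R g y + e *\<^sub>R g x"
    using e d assms(3) by (simp add: g_add scaleR_add_right add.commute)
  then have "d = c" using independent_pair_coeff_eq g_not_in_span[OF assms(1,2)] by blast
  with d show ?thesis by simp
qed

lemma g_scale: "g (t *\<^sub>R x) = t *\<^sub>R g x"
proof -
  obtain x0 where x0: "x0 \<notin> span {0 :: 'a}" by (rule ex_not_in_span_singleton)
  then have "x0 \<noteq> 0" by auto
  then have "\<exists>c. g (t *\<^sub>R x0) = c *\<^sub>R g x0" for t
    using g_scale_in_span by (auto simp: real_vector.span_singleton)
  then obtain h where h0: "g (t *\<^sub>R x0) = h t *\<^sub>R g x0" for t by metis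
  have h: "g (t *\<^sub>R x) = h t *\<^sub>R g x" for t x
  proof (cases "x \<in> span {x0}")
    case False
    then show ?thesis using g_scale_transfer \<open>x0 \<noteq> 0\<close> h0 by blast
  next
    case True
    \<comment> \<open>Vectors on the line of \<open>x0\<close> cannot be compared with
      \<open>x0\<close> directly; the factor travels from \<open>x0\<close> to \<open>z\<close> and
      back to \<open>x\<close>.\<close>
    obtain z where z: "z \<notin> span {x0}" by (rule ex_not_in_span_singleton)
    then have "z \<noteq> 0" using real_vector.span_zero by blast
    have gz: "g (t *\<^sub>R z) = h t *\<^sub>R g z"
      using g_scale_transfer z \<open>x0 \<noteq> 0\<close> h0 by blast
    show ?thesis
    proof (cases "x = 0")
      case False
      have "span {x} \<subseteq> span {x0}"
        using True by (intro real_vector.span_minimal real_vector.subspace_span) auto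
      then have "x \<notin> span {z}" using not_in_span_sym[of z x] z False by blast
      then show ?thesis using g_scale_transfer \<open>z \<noteq> 0\<close> gz by blast
    qed simp
  qed
  obtain z where z: "z \<notin> span {x0}" by (rule ex_not_in_span_singleton)
  have gx0: "g x0 \<noteq> 0" using g_not_in_span(2)[OF z \<open>x0 \<noteq> 0\<close>] .
  have "h t = t"
  proof (rule real_ring_endomorphism_id)
    show "h 1 = 1" using h0[of 1] gx0 by (metis scaleR_cancel_right scaleR_one)
    show "h (a + b) = h a + h b" for a b
    proof -
      have "h (a + b) *\<^sub>R g x0 = (h a + h b) *\<^sub>R g x0"
        by (simp add: h0[symmetric] scaleR_add_left g_add)
      then show ?thesis using gx0 by simp
    qed
    \<comment> \<open>The factor for \<open>a\<close> is needed at \<open>b *\<^sub>R x0\<close>,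
      which is why \<open>h\<close> was first shown to serve all vectors.\<close>
    show "h (a * b) = h a * h b" for a b
    proof -
      have "h (a * b) *\<^sub>R g x0 = g (a *\<^sub>R (b *\<^sub>R x0))" by (simp flip: h0)
      also have "\<dots> = (h a * h b) *\<^sub>R g x0"
        unfolding h[of a "b *\<^sub>R x0"] h0[of b] by simp
      finally show ?thesis using gx0 by simp
    qed
  qed
  then show ?thesis by (simp add: h)
qed

lemma linear_g: "linear g"
  by (rule linearI) (simp_all add: g_add g_scale)

section \<open>From linearity to isometry\<close>

text \<open>A linear map carries dependence relations over, which settles value 0. Otherwise scale
  the first entry to reach \<open>n\<close>-norm one and pull the factor out on both sides.\<close>

lemma norm_map_g:
  assumes "length vs = n"
  shows "NY (map g vs) = NX vs"
proof (cases "NX vs = 0")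
  case True
  then obtain c where c: "\<exists>i<length vs. c i \<noteq> 0" "(\<Sum>i<length vs. c i *\<^sub>R vs ! i) = 0"
    using X.zero_iff[OF assms] by (auto simp: lin_dependent_tuple_def)
  have "(\<Sum>i<length vs. c i *\<^sub>R g (vs ! i)) = g (\<Sum>i<length vs. c i *\<^sub>R vs ! i)"
    by (simp add: linear_sum[OF linear_g] g_scale)
  then have "lin_dependent_tuple (map g vs)"
    unfolding lin_dependent_tuple_def using c by (intro exI[of _ c]) auto
  then show ?thesis using True Y.zero_iff[of "map g vs"] assms by simp
next
  case False
  obtain v vs' where vs: "vs = v # vs'" using assms n_ge_2 by (cases vs) auto
  have len: "length (a # vs') = n" "length (b # map g vs') = n" for a b
    using assms vs by auto
  have pos: "NX vs > 0" using False X.nonneg[OF len(1), of v] vs by simp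
  then have "NX (((1 / NX vs) *\<^sub>R v) # vs') = 1" using X.scale[OF len(1)] vs by simp
  then have "NY (g ((1 / NX vs) *\<^sub>R v) # map g vs') = 1"
    using unit_diff[OF len(1), of "(1 / NX vs) *\<^sub>R v" 0] by (simp add: g_def)
  then show ?thesis
    using pos Y.scale[OF len(2), of "1 / NX vs" "g v"] vs by (simp add: g_scale)
qed

lemma affine_n_isometry: "affine_map f \<and> n_isometry n NX NY f"
proof
  show "affine_map f" using linear_g by (simp add: affine_map_def g_def[abs_def])
  have "map2 (\<lambda>x y. f x - f y) xs ys = map g (map2 (\<lambda>x y. x - y) xs ys)" for xs ys
    using linear_diff[OF linear_g] by (auto simp: g_def)
  then show "n_isometry n NX NY f"
    unfolding n_isometry_def using norm_map_g by (metis length_map map_fst_zip)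
qed

end

theorem theorem2p6:
  fixes n :: nat
    and NX :: "'a::real_vector list \<Rightarrow> real"
    and NY :: "'b::real_vector list \<Rightarrow> real"
    and f :: "'a \<Rightarrow> 'b"
  assumes "n \<ge> 2"
    and "n_normed_space n NX"
    and "n_normed_space n NY"
    and "surj f"
    and "preserves_n_distance_one n NX NY f"
  shows "affine_map f \<and> n_isometry n NX NY f"
proof -
  interpret n_normed_space n NX by fact
  interpret Y: n_normed_space n NY by fact
  interpret surj_n_distance_one n NX NY f
    by unfold_locales (use assms in auto)
  show ?thesis by (rule affine_n_isometry)
qed

end
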